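(* Let $G$ be a group and let $p$ be a prime number. Let $x \in L_3(G)$ be a left $3$-Engel element of $G$ such that $x^{p^n}=1$ for some integer $n>1$. Then the normal closure $\langle x^p\rangle^G$ is soluble of derived length at most $n-1$, and $x^p$ belongs to $B(G)$, the Baer radical of $G$. In particular, $x^p$ belongs to $HP(G)$, the Hirsch-Plotkin radical of $G$.
   Context: For elements $a,b$ of a group $G$ put $[a,{}_0 b]:=a$, $[a,b]=[a,{}_1 b]:=a^{-1}b^{-1}ab$, and $[a,{}_n b]:=[[a,{}_{n-1}b],b]$ for $n>0$. An element $x\in G$ is a left $n$-Engel element if $[g,{}_n x]=1$ for all $g\in G$; $L_n(G)$ denotes the set of all left $n$-Engel elements of $G$. For $z\in G$, $\langle z\rangle^G$ denotes the normal closure of $z$ in $G$, i.e. the smallest normal subgroup of $G$ containing $z$. The Baer radical $B(G)$ is the subgroup generated by all cyclic subnormal subgroups of $G$ (equivalently, the set of all $z\in G$ with $\langle z\rangle$ subnormal in $G$). The Hirsch-Plotkin radical $HP(G)$ is the unique largest normal locally nilpotent subgroup of $G$. The group $G$ is not assumed finite. *)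

theory Defs
  imports "HOL-Algebra.Algebra"
begin

definition commutator :: "('a, 'b) monoid_scheme \<Rightarrow> 'a \<Rightarrow> 'a \<Rightarrow> 'a" where
  "commutator G a b = inv\<^bsub>G\<^esub> a \<otimes>\<^bsub>G\<^esub> inv\<^bsub>G\<^esub> b \<otimes>\<^bsub>G\<^esub> a \<otimes>\<^bsub>G\<^esub> b"

primrec engel_commutator :: "('a, 'b) monoid_scheme \<Rightarrow> 'a \<Rightarrow> 'a \<Rightarrow> nat \<Rightarrow> 'a" where
  "engel_commutator G a b 0 = a"
| "engel_commutator G a b (Suc n) = commutator G (engel_commutator G a b n) b"

definition left_engel :: "nat \<Rightarrow> ('a, 'b) monoid_scheme \<Rightarrow> 'a set" where
  "left_engel n G = {x \<in> carrier G. \<forall>g \<in> carrier G. engel_commutator G g x n = \<one>\<^bsub>G\<^esub>}"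

definition normal_closure :: "('a, 'b) monoid_scheme \<Rightarrow> 'a \<Rightarrow> 'a set" where
  "normal_closure G z = \<Inter> {N. N \<lhd> G \<and> z \<in> N}"

text \<open>Meaningful only for solvable \<open>G\<close>; otherwise the \<open>LEAST\<close> is unspecified.\<close>

definition derived_length :: "('a, 'b) monoid_scheme \<Rightarrow> nat" where
  "derived_length G = (LEAST d. (derived G ^^ d) (carrier G) = {\<one>\<^bsub>G\<^esub>})"

inductive subnormal :: "('a, 'b) monoid_scheme \<Rightarrow> 'a set \<Rightarrow> bool" for G where
  whole: "subnormal G (carrier G)"
| step: "\<lbrakk>subnormal G K; H \<lhd> G\<lparr>carrier := K\<rparr>\<rbrakk> \<Longrightarrow> subnormal G H"

definition baer_radical :: "('a, 'b) monoid_scheme \<Rightarrow> 'a set" where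
  "baer_radical G =
     generate G (\<Union> {generate G {z} | z. z \<in> carrier G \<and> subnormal G (generate G {z})})"

text \<open>Indexed from 0: \<open>lower_central G n\<close> is the term usually written $\gamma_{n+1}(G)$.\<close>

primrec lower_central :: "('a, 'b) monoid_scheme \<Rightarrow> nat \<Rightarrow> 'a set" where
  "lower_central G 0 = carrier G"
| "lower_central G (Suc n) =
     generate G {commutator G a b | a b. a \<in> lower_central G n \<and> b \<in> carrier G}"

definition nilpotent :: "('a, 'b) monoid_scheme \<Rightarrow> bool" where
  "nilpotent G \<longleftrightarrow> (\<exists>c. lower_central G c = {\<one>\<^bsub>G\<^esub>})"

definition locally_nilpotent :: "('a, 'b) monoid_scheme \<Rightarrow> bool" where
  "locally_nilpotent G \<longleftrightarrow>
     (\<forall>S. finite S \<and> S \<subseteq> carrier G \<longrightarrow> nilpotent (subgroup_generated G S))"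

text \<open>The order on sets is inclusion, so \<open>GREATEST\<close> picks the normal locally nilpotent
  subgroup that contains every other one; it exists by the Hirsch--Plotkin theorem.\<close>

definition hirsch_plotkin_radical :: "('a, 'b) monoid_scheme \<Rightarrow> 'a set" where
  "hirsch_plotkin_radical G = (GREATEST H. H \<lhd> G \<and> locally_nilpotent (G\<lparr>carrier := H\<rparr>))"

end

theory Submission
  imports Defs
begin

text \<open>
  Write \<open>x\<^sup>g = g\<^sup>-\<^sup>1xg\<close>. Since \<open>[g, x] = (x\<^sup>g)\<^sup>-\<^sup>1x\<close>, the identity \<open>[g, x, x, x] = 1\<close> unwinds to
  the statement that \<open>x\<close> commutes with \<open>x\<^sup>y\<close> for every conjugate \<open>y = x\<^sup>g\<close>
  (\<open>left_3_engel_commutes\<close>). Conjugating the same statement for \<open>g\<^sup>-\<^sup>1\<close> by \<open>g\<close> shows that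
  \<open>y\<close> commutes with \<open>y\<^sup>x\<close>, so \<open>[x, y]\<close> commutes with both \<open>x\<close> and \<open>y\<close>: a left 3-Engel element
  and any of its conjugates generate a group of class at most 2. In such a group the commutator is
  bilinear, so \<open>[x\<^sup>i, y\<^sup>j] = [x, y]\<^sup>i\<^sup>j = [x\<^sup>i\<^sup>j, y]\<close>, which lies in the normal closure of \<open>x\<^sup>i\<^sup>j\<close>.
  Passing from generators to the subgroups they generate, the commutator of the normal closures of
  \<open>x\<^sup>i\<close> and \<open>x\<^sup>j\<close> lies in the normal closure of \<open>x\<^sup>i\<^sup>j\<close>
  (\<open>commutator_normal_closures_of_powers\<close>).

  Hence the normal closures of \<open>x\<^sup>p\<close>, of the \<open>p\<^sup>2\<close>-th power of \<open>x\<close>, and so on up to the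
  \<open>p\<^sup>n\<close>-th power \<open>1\<close>, form a central series of length \<open>n - 1\<close> of the normal closure \<open>A\<close> of \<open>x\<^sup>p\<close>.
  So \<open>A\<close> is even nilpotent of class at most \<open>n - 1\<close>, and everything follows: the derived series
  descends at least as fast as any central series; a subgroup of the nilpotent normal subgroup \<open>A\<close>
  is subnormal, which puts \<open>x\<^sup>p\<close> into the Baer radical; and a nilpotent normal subgroup is a locally
  nilpotent one, which puts \<open>x\<^sup>p\<close> into the Hirsch-Plotkin radical.

  The last step relies on the Hirsch-Plotkin theorem, that a largest locally nilpotent normal
  subgroup exists (\<open>subset_hirsch_plotkin_radical\<close>). The product of two such subgroups \<open>H\<close> and \<open>K\<close>
  is again one (\<open>locally_nilpotent_set_mult\<close>), so these subgroups form a directed family. For the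
  product, take finite sets \<open>S \<subseteq> H\<close> and \<open>T \<subseteq> K\<close> that are closed under inverses and let \<open>F\<close> be the group generated by \<open>S \<union> T\<close>.
  The commutators of \<open>T\<close> with \<open>S\<close> lie in \<open>H \<inter> K\<close>, and the nilpotency inside \<open>H\<close> makes the process
  of taking further commutators with \<open>S\<close> stop after finitely many steps. The finite set so reached
  generates together with \<open>T\<close> a subgroup of \<open>K\<close> that is finitely generated, hence nilpotent, and
  normal in \<open>F\<close>. Exchanging the roles of \<open>S\<close> and \<open>T\<close> gives a second nilpotent normal subgroup, and
  Fitting's theorem (\<open>nilpotent_generate_Un\<close>) applies to the two.
\<close>

section \<open>Conjugation and commutators\<close>

definition conjugate :: "('a, 'b) monoid_scheme \<Rightarrow> 'a \<Rightarrow> 'a \<Rightarrow> 'a" where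
  "conjugate G a g = inv\<^bsub>G\<^esub> g \<otimes>\<^bsub>G\<^esub> a \<otimes>\<^bsub>G\<^esub> g"

definition conj_invariant :: "('a, 'b) monoid_scheme \<Rightarrow> 'a set \<Rightarrow> 'a set \<Rightarrow> bool" where
  "conj_invariant G N S \<longleftrightarrow> (\<forall>g\<in>S. \<forall>a\<in>N. conjugate G a g \<in> N)"

lemma conj_invariantD: "conj_invariant G N S \<Longrightarrow> g \<in> S \<Longrightarrow> a \<in> N \<Longrightarrow> conjugate G a g \<in> N"
  by (simp add: conj_invariant_def)

lemma conj_invariant_mono: "conj_invariant G N Y \<Longrightarrow> S \<subseteq> Y \<Longrightarrow> conj_invariant G N S"
  by (auto simp: conj_invariant_def)

lemma conj_invariant_Int:
  "conj_invariant G M S \<Longrightarrow> conj_invariant G N S \<Longrightarrow> conj_invariant G (M \<inter> N) S"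
  by (simp add: conj_invariant_def)

context group
begin

lemma inv_mult_cancel: "a \<in> carrier G \<Longrightarrow> b \<in> carrier G \<Longrightarrow> inv a \<otimes> (a \<otimes> b) = b"
  by (metis inv_closed l_inv l_one m_assoc)

lemma mult_inv_cancel: "a \<in> carrier G \<Longrightarrow> b \<in> carrier G \<Longrightarrow> a \<otimes> (inv a \<otimes> b) = b"
  by (metis inv_closed r_inv l_one m_assoc)

lemmas word_simps = m_assoc inv_mult_group inv_mult_cancel mult_inv_cancel

lemma conjugate_closed [simp]: "a \<in> carrier G \<Longrightarrow> g \<in> carrier G \<Longrightarrow> conjugate G a g \<in> carrier G"
  by (simp add: conjugate_def)

lemma commutator_closed [simp]: "a \<in> carrier G \<Longrightarrow> b \<in> carrier G \<Longrightarrow> commutator G a b \<in> carrier G"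
  by (simp add: commutator_def)

lemma conjugate_of_one [simp]: "g \<in> carrier G \<Longrightarrow> conjugate G \<one> g = \<one>"
  by (simp add: conjugate_def)

lemma conjugate_by_one [simp]: "a \<in> carrier G \<Longrightarrow> conjugate G a \<one> = a"
  by (simp add: conjugate_def)

lemma conjugate_mult:
  "\<lbrakk>a \<in> carrier G; b \<in> carrier G; g \<in> carrier G\<rbrakk>
    \<Longrightarrow> conjugate G (a \<otimes> b) g = conjugate G a g \<otimes> conjugate G b g"
  by (simp add: conjugate_def word_simps)

lemma conjugate_inv:
  "\<lbrakk>a \<in> carrier G; g \<in> carrier G\<rbrakk> \<Longrightarrow> conjugate G (inv a) g = inv (conjugate G a g)"
  by (simp add: conjugate_def word_simps)

lemma conjugate_conjugate:
  "\<lbrakk>a \<in> carrier G; g \<in> carrier G; h \<in> carrier G\<rbrakk>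
    \<Longrightarrow> conjugate G (conjugate G a g) h = conjugate G a (g \<otimes> h)"
  by (simp add: conjugate_def word_simps)

lemma conjugate_pow:
  "\<lbrakk>a \<in> carrier G; g \<in> carrier G\<rbrakk> \<Longrightarrow> conjugate G (a [^] (k::nat)) g = conjugate G a g [^] k"
  by (induction k) (simp_all add: conjugate_mult)

lemma conjugate_commutator:
  "\<lbrakk>a \<in> carrier G; b \<in> carrier G; g \<in> carrier G\<rbrakk>
    \<Longrightarrow> conjugate G (commutator G a b) g = commutator G (conjugate G a g) (conjugate G b g)"
  by (simp add: conjugate_def commutator_def word_simps)

lemma commutator_eq_inv_mult_conjugate:
  "\<lbrakk>a \<in> carrier G; b \<in> carrier G\<rbrakk> \<Longrightarrow> commutator G a b = inv a \<otimes> conjugate G a b"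
  by (simp add: conjugate_def commutator_def word_simps)

lemma commutator_eq_conjugate_mult:
  "\<lbrakk>a \<in> carrier G; b \<in> carrier G\<rbrakk> \<Longrightarrow> commutator G a b = conjugate G (inv b) a \<otimes> b"
  by (simp add: conjugate_def commutator_def word_simps)

lemma conjugate_eq_mult_commutator:
  "\<lbrakk>a \<in> carrier G; b \<in> carrier G\<rbrakk> \<Longrightarrow> conjugate G a b = a \<otimes> commutator G a b"
  by (simp add: conjugate_def commutator_def word_simps)

lemma commutator_one_left [simp]: "b \<in> carrier G \<Longrightarrow> commutator G \<one> b = \<one>"
  by (simp add: commutator_def)

lemma commutator_one_right [simp]: "a \<in> carrier G \<Longrightarrow> commutator G a \<one> = \<one>"
  by (simp add: commutator_def)

lemma commutator_mult_left:
  "\<lbrakk>a \<in> carrier G; b \<in> carrier G; y \<in> carrier G\<rbrakk>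
    \<Longrightarrow> commutator G (a \<otimes> b) y = conjugate G (commutator G a y) b \<otimes> commutator G b y"
  by (simp add: conjugate_def commutator_def word_simps)

lemma commutator_inv_left:
  "\<lbrakk>a \<in> carrier G; y \<in> carrier G\<rbrakk>
    \<Longrightarrow> commutator G (inv a) y = inv (conjugate G (commutator G a y) (inv a))"
  by (simp add: conjugate_def commutator_def word_simps)

lemma commutator_mult_right:
  "\<lbrakk>a \<in> carrier G; b \<in> carrier G; y \<in> carrier G\<rbrakk>
    \<Longrightarrow> commutator G y (a \<otimes> b) = commutator G y b \<otimes> conjugate G (commutator G y a) b"
  by (simp add: conjugate_def commutator_def word_simps)

lemma commutator_inv_right:
  "\<lbrakk>a \<in> carrier G; y \<in> carrier G\<rbrakk>
    \<Longrightarrow> commutator G y (inv a) = inv (conjugate G (commutator G y a) (inv a))"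
  by (simp add: conjugate_def commutator_def word_simps)

lemma conj_invariant_generate:
  assumes "Y \<subseteq> carrier G" "S \<subseteq> carrier G"
    and "\<And>y g. y \<in> Y \<Longrightarrow> g \<in> S \<Longrightarrow> conjugate G y g \<in> generate G Y"
  shows "conj_invariant G (generate G Y) S"
  unfolding conj_invariant_def
proof (intro ballI)
  fix g a assume g: "g \<in> S" and a: "a \<in> generate G Y"
  note sg = generate_is_subgroup[OF assms(1)]
  from a show "conjugate G a g \<in> generate G Y"
  proof (induction a)
    case one then show ?case using g assms(2) by (auto simp: subset_eq intro: generate.one)
  next
    case (incl h) then show ?case using assms(3) g by simp
  next
    case (inv h)
    then show ?case
      using assms g subgroup.m_inv_closed[OF sg assms(3)[OF inv g]]
      by (auto simp: conjugate_inv subset_eq)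
  next
    case (eng h1 h2)
    then show ?case
      using generate_in_carrier[OF assms(1)] g assms(2)
      by (auto simp: conjugate_mult subset_eq intro: generate.eng)
  qed
qed

text \<open>
  The set \<open>S\<close> has to be closed under inverses: in an infinite group a conjugation can map a subgroup
  properly into itself, and then the inverse conjugation does not preserve it.
\<close>

lemma conj_invariant_generate_right:
  assumes "N \<subseteq> carrier G" "S \<subseteq> carrier G"
    and inv_X: "\<And>g. g \<in> S \<Longrightarrow> inv g \<in> S"
    and "conj_invariant G N S"
  shows "conj_invariant G N (generate G S)"
  unfolding conj_invariant_def
proof
  fix g assume "g \<in> generate G S"
  then show "\<forall>a\<in>N. conjugate G a g \<in> N"
  proof (induction g)
    case one then show ?case using assms(1) by (auto simp: subset_eq)
  next
    case (incl h) then show ?case using assms(4) by (simp add: conj_invariant_def)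
  next
    case (inv h) then show ?case using assms(4) inv_X by (simp add: conj_invariant_def)
  next
    case (eng h1 h2)
    show ?case
    proof
      fix a assume "a \<in> N"
      then have "conjugate G (conjugate G a h1) h2 \<in> N"
        using eng.IH by blast
      then show "conjugate G a (h1 \<otimes> h2) \<in> N"
        using \<open>a \<in> N\<close> assms(1) eng.hyps generate_in_carrier[OF assms(2)]
        by (metis conjugate_conjugate subsetD)
    qed
  qed
qed

text \<open>
  This is the passage from generators to subgroups used for every central series below. The expansions
  of \<open>[ab, y]\<close> and \<open>[a, bc]\<close> are products of conjugates of commutators with fewer factors, and the
  invariance of \<open>N\<close> absorbs the conjugations.
\<close>

lemma commutator_generate_in:
  assumes N: "subgroup N G" and S: "S \<subseteq> carrier G" and Y: "Y \<subseteq> carrier G"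
    and NX: "conj_invariant G N (generate G S)"
    and NY: "conj_invariant G N (generate G Y)"
    and XY: "\<And>x y. x \<in> S \<Longrightarrow> y \<in> Y \<Longrightarrow> commutator G x y \<in> N"
    and a: "a \<in> generate G S" and b: "b \<in> generate G Y"
  shows "commutator G a b \<in> N"
proof -
  note carrX = generate_in_carrier[OF S] and carrY = generate_in_carrier[OF Y]
  have left: "commutator G a y \<in> N" if y: "y \<in> Y" for y
    using a
  proof (induction a)
    case one then show ?case using y Y subgroup.one_closed[OF N] by (auto simp: subset_eq)
  next
    case (incl h) then show ?case using XY y by simp
  next
    case (inv h)
    have "conjugate G (commutator G h y) (inv h) \<in> N"
      using NX generate.inv[OF inv] XY[OF inv y] by (rule conj_invariantD)
    then show ?case
      using commutator_inv_left[of h y] subsetD[OF S inv] subsetD[OF Y y] subgroup.m_inv_closed[OF N]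
      by auto
  next
    case (eng h1 h2)
    have "conjugate G (commutator G h1 y) h2 \<in> N"
      using NX eng by (blast intro: conj_invariantD)
    then show ?case
      using commutator_mult_left[of h1 h2 y] eng carrX y Y subgroup.m_closed[OF N] by auto
  qed
  have ac: "a \<in> carrier G" using a carrX by simp
  show ?thesis
    using b
  proof (induction b)
    case one then show ?case using ac subgroup.one_closed[OF N] by simp
  next
    case (incl h) then show ?case using left by simp
  next
    case (inv h)
    have "conjugate G (commutator G a h) (inv h) \<in> N"
      using NY generate.inv[OF inv] left[OF inv] by (rule conj_invariantD)
    then show ?case
      using commutator_inv_right[of h a] subsetD[OF Y inv] ac subgroup.m_inv_closed[OF N] by auto
  next
    case (eng h1 h2)
    have "conjugate G (commutator G a h1) h2 \<in> N"
      using NY eng by (blast intro: conj_invariantD)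
    then show ?case
      using commutator_mult_right[of h1 h2 a] eng carrY ac subgroup.m_closed[OF N] by auto
  qed
qed

lemma normal_iff_conj_invariant:
  "N \<lhd> G \<longleftrightarrow> subgroup N G \<and> conj_invariant G N (carrier G)"
proof -
  have "(\<forall>x\<in>carrier G. \<forall>h\<in>N. x \<otimes> h \<otimes> inv x \<in> N) \<longleftrightarrow> conj_invariant G N (carrier G)"
    unfolding conj_invariant_def conjugate_def by (metis inv_closed inv_inv)
  then show ?thesis by (simp add: normal_inv_iff)
qed

lemma normal_in_subgroup:
  assumes "subgroup K G" "subgroup W G" "W \<subseteq> K" "conj_invariant G W K"
  shows "W \<lhd> G\<lparr>carrier := K\<rparr>"
proof -
  interpret K: group "G\<lparr>carrier := K\<rparr>"
    using assms(1) by (rule subgroup_imp_group)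
  have "subgroup W (G\<lparr>carrier := K\<rparr>)"
    using assms subgroup_incl by blast
  moreover have "conj_invariant (G\<lparr>carrier := K\<rparr>) W K"
    using assms by (auto simp: conj_invariant_def conjugate_def)
  ultimately show ?thesis by (simp add: K.normal_iff_conj_invariant)
qed

lemma conj_invariant_subgroup_self: "subgroup N G \<Longrightarrow> conj_invariant G N N"
  by (simp add: conj_invariant_def conjugate_def subgroup.m_closed subgroup.m_inv_closed)

end

section \<open>Central series and nilpotency\<close>

text \<open>
  The terms need not be contained in \<open>A\<close>, and a series of \<open>A\<close> is therefore also one of each
  subgroup of \<open>A\<close>.
\<close>

definition central_series ::
    "('a, 'b) monoid_scheme \<Rightarrow> 'a set \<Rightarrow> (nat \<Rightarrow> 'a set) \<Rightarrow> bool" where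
  "central_series G A L \<longleftrightarrow> (\<forall>k. subgroup (L k) G) \<and> A \<subseteq> L 0
     \<and> (\<forall>k. \<forall>a\<in>L k. \<forall>b\<in>A. commutator G a b \<in> L (Suc k))"

context group
begin

abbreviation lower_central_in :: "'a set \<Rightarrow> nat \<Rightarrow> 'a set" where
  "lower_central_in A \<equiv> lower_central (G\<lparr>carrier := A\<rparr>)"

lemma lower_central_in_Suc:
  assumes "subgroup A G" "lower_central_in A k \<subseteq> A"
  shows "lower_central_in A (Suc k) =
    generate G {commutator G a b | a b. a \<in> lower_central_in A k \<and> b \<in> A}"
proof -
  have eq: "{commutator (G\<lparr>carrier := A\<rparr>) a b | a b. a \<in> lower_central_in A k \<and> b \<in> A}
      = {commutator G a b | a b. a \<in> lower_central_in A k \<and> b \<in> A}" (is "_ = ?C")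
    using assms by (force simp: commutator_def subset_eq)
  have "?C \<subseteq> A"
    using assms by (auto simp: commutator_def subset_eq subgroup.m_closed subgroup.m_inv_closed)
  then have "generate (G\<lparr>carrier := A\<rparr>) ?C = generate G ?C"
    using assms(1) by (rule generate_consistent)
  then show ?thesis by (simp add: eq)
qed

lemma lower_central_in_subgroup:
  assumes A: "subgroup A G"
  shows "subgroup (lower_central_in A k) G \<and> lower_central_in A k \<subseteq> A"
proof (induction k)
  case 0
  then show ?case using A by simp
next
  case (Suc k)
  let ?C = "{commutator G a b | a b. a \<in> lower_central_in A k \<and> b \<in> A}"
  have C: "?C \<subseteq> A"
    using Suc A by (auto simp: commutator_def subset_eq subgroup.m_closed subgroup.m_inv_closed)
  then have "subgroup (generate G ?C) G"
    using subgroup.subset[OF A] by (intro generate_is_subgroup) blast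
  moreover have "generate G ?C \<subseteq> A"
    using C A by (rule generate_subgroup_incl)
  ultimately show ?case
    using lower_central_in_Suc[OF A] Suc by simp
qed

lemma commutator_in_lower_central_Suc:
  assumes "subgroup A G" "a \<in> lower_central_in A k" "b \<in> A"
  shows "commutator G a b \<in> lower_central_in A (Suc k)"
  using assms lower_central_in_Suc[OF assms(1), of k] lower_central_in_subgroup[OF assms(1), of k]
  by (auto intro!: generate.incl)

lemma central_series_lower_central:
  "subgroup A G \<Longrightarrow> central_series G A (lower_central_in A)"
  unfolding central_series_def
  using lower_central_in_subgroup commutator_in_lower_central_Suc by auto

lemma lower_central_in_subset_central_series:
  assumes A: "subgroup A G" and L: "central_series G A L"
  shows "lower_central_in A k \<subseteq> L k"
proof (induction k)
  case 0
  then show ?case using L by (simp add: central_series_def)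
next
  case (Suc k)
  have "{commutator G a b | a b. a \<in> lower_central_in A k \<and> b \<in> A} \<subseteq> L (Suc k)"
    using L Suc by (auto simp: central_series_def)
  then show ?case
    using lower_central_in_Suc[OF A, of k] lower_central_in_subgroup[OF A, of k] L
      generate_subgroup_incl by (simp add: central_series_def)
qed

lemma lower_central_in_trivial_mono:
  assumes A: "subgroup A G" and c: "lower_central_in A c = {\<one>}" and "c \<le> k"
  shows "lower_central_in A k = {\<one>}"
  using \<open>c \<le> k\<close>
proof (induction k rule: dec_induct)
  case base
  then show ?case using c .
next
  case (step k)
  have "{commutator G a b | a b. a \<in> lower_central_in A k \<and> b \<in> A} \<subseteq> {\<one>}"
    using step.IH subgroup.subset[OF A] by (auto simp: subset_eq)
  then have "lower_central_in A (Suc k) \<subseteq> {\<one>}"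
    using lower_central_in_Suc[OF A, of k] lower_central_in_subgroup[OF A, of k]
      generate_subgroup_incl[OF _ triv_subgroup] by simp
  then show ?case
    using lower_central_in_subgroup[OF A, of "Suc k"] subgroup.one_closed by blast
qed

text \<open>
  The lower central series is the fastest descending central series, so any central series that reaches
  the trivial group is a certificate of nilpotency.
\<close>

lemma nilpotent_iff_central_series:
  assumes A: "subgroup A G"
  shows "nilpotent (G\<lparr>carrier := A\<rparr>) \<longleftrightarrow> (\<exists>L c. central_series G A L \<and> L c = {\<one>})"
proof
  assume "nilpotent (G\<lparr>carrier := A\<rparr>)"
  then show "\<exists>L c. central_series G A L \<and> L c = {\<one>}"
    using central_series_lower_central[OF A] by (auto simp: nilpotent_def)
next
  assume "\<exists>L c. central_series G A L \<and> L c = {\<one>}"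
  then obtain L c where "central_series G A L" "L c = {\<one>}" by blast
  then have "lower_central_in A c \<subseteq> {\<one>}"
    using lower_central_in_subset_central_series[OF A] by metis
  then have "lower_central_in A c = {\<one>}"
    using lower_central_in_subgroup[OF A, of c] subgroup.one_closed by blast
  then show "nilpotent (G\<lparr>carrier := A\<rparr>)" by (auto simp: nilpotent_def)
qed

lemma nilpotent_subgroup:
  assumes "subgroup A G" "subgroup B G" "B \<subseteq> A" "nilpotent (G\<lparr>carrier := A\<rparr>)"
  shows "nilpotent (G\<lparr>carrier := B\<rparr>)"
proof -
  obtain L c where "central_series G A L" "L c = {\<one>}"
    using assms nilpotent_iff_central_series by blast
  moreover from this have "central_series G B L"
    using assms(3) by (auto simp: central_series_def)
  ultimately show ?thesis
    using assms(2) nilpotent_iff_central_series by blast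
qed

text \<open>
  The terms of the lower central series are characteristic; for conjugations this is the fact that
  \<open>[a, b]\<^sup>g = [a\<^sup>g, b\<^sup>g]\<close>.
\<close>

lemma conj_invariant_lower_central:
  assumes A: "subgroup A G" and S: "S \<subseteq> carrier G" and inv: "conj_invariant G A S"
  shows "conj_invariant G (lower_central_in A k) S"
proof (induction k)
  case 0
  then show ?case using inv by simp
next
  case (Suc k)
  let ?C = "{commutator G a b | a b. a \<in> lower_central_in A k \<and> b \<in> A}"
  note sub = lower_central_in_subgroup[OF A, of k]
  have Ac: "A \<subseteq> carrier G" by (rule subgroup.subset[OF A])
  have C: "?C \<subseteq> carrier G" using sub Ac by (auto simp: subset_eq)
  have "conjugate G y g \<in> generate G ?C" if y: "y \<in> ?C" and g: "g \<in> S" for y g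
  proof -
    obtain a b where ab: "y = commutator G a b" "a \<in> lower_central_in A k" "b \<in> A"
      using y by blast
    have "conjugate G a g \<in> lower_central_in A k" "conjugate G b g \<in> A"
      using ab g Suc inv by (auto dest: conj_invariantD)
    moreover have "conjugate G y g = commutator G (conjugate G a g) (conjugate G b g)"
      using ab sub Ac g S by (auto simp: conjugate_commutator subset_eq)
    ultimately show ?thesis by (auto intro!: generate.incl)
  qed
  then have "conj_invariant G (generate G ?C) S"
    using C S by (intro conj_invariant_generate) auto
  then show ?case
    using lower_central_in_Suc[OF A, of k] sub by simp
qed

lemma derived_series_subset_central_series:
  assumes A: "subgroup A G" and L: "central_series G A L"
  shows "(derived G ^^ k) A \<subseteq> L k \<and> (derived G ^^ k) A \<subseteq> A"
proof (induction k)
  case 0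
  then show ?case using L by (simp add: central_series_def)
next
  case (Suc k)
  let ?D = "(derived G ^^ k) A"
  have D: "subgroup ?D G" using A by (rule exp_of_derived_is_subgroup)
  have "x \<otimes> y \<otimes> inv x \<otimes> inv y \<in> L (Suc k)" if xy: "x \<in> ?D" "y \<in> ?D" for x y
  proof -
    have "inv x \<in> L k" "inv y \<in> A"
      using xy Suc subgroup.m_inv_closed[OF D] by auto
    then have "commutator G (inv x) (inv y) \<in> L (Suc k)"
      using L by (simp add: central_series_def)
    then show ?thesis
      using xy subgroup.subset[OF D] by (auto simp: commutator_def subset_eq)
  qed
  then have "derived G ?D \<subseteq> L (Suc k)"
    unfolding derived_def using L
    by (intro generate_subgroup_incl) (auto simp: central_series_def)
  moreover have "derived G ?D \<subseteq> A"
    using derived_incl[of ?D A] Suc A by simp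
  ultimately show ?case by simp
qed

text \<open>
  By \<open>derived_series_subset_central_series\<close>, the nilpotency class bounds the derived length.
\<close>

lemma derived_length_le_of_central_series:
  assumes A: "subgroup A G" and L: "central_series G A L" "L c = {\<one>}"
  shows "solvable (G\<lparr>carrier := A\<rparr>)" "derived_length (G\<lparr>carrier := A\<rparr>) \<le> c"
proof -
  interpret A: group "G\<lparr>carrier := A\<rparr>" using A by (rule subgroup_imp_group)
  have eq: "(derived (G\<lparr>carrier := A\<rparr>) ^^ k) A = (derived G ^^ k) A" for k
  proof (induction k)
    case (Suc k)
    then show ?case
      using derived_series_subset_central_series[OF A L(1), of k] derived_consistent[OF _ A] by simp
  qed simp
  have "(derived G ^^ c) A \<subseteq> {\<one>}"
    using derived_series_subset_central_series[OF A L(1), of c] L(2) by simp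
  then have "(derived G ^^ c) A = {\<one>}"
    using subgroup.one_closed[OF exp_of_derived_is_subgroup[OF A, of c]] by blast
  then have triv: "(derived (G\<lparr>carrier := A\<rparr>) ^^ c) A = {\<one>}" by (simp add: eq)
  then show "solvable (G\<lparr>carrier := A\<rparr>)"
    using A.solvable_iff_trivial_derived_seq by auto
  show "derived_length (G\<lparr>carrier := A\<rparr>) \<le> c"
    unfolding derived_length_def using triv by (intro Least_le) simp
qed

text \<open>
  Each term of the lower central series is central in \<open>A\<close> modulo the next one, so it normalizes the
  product of \<open>H\<close> with the next one. These products descend from \<open>A\<close> to \<open>H\<close>.
\<close>

lemma subnormal_of_nilpotent:
  assumes A: "subgroup A G" "subnormal G A" and nil: "nilpotent (G\<lparr>carrier := A\<rparr>)"
    and H: "subgroup H G" "H \<subseteq> A"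
  shows "subnormal G H"
proof -
  let ?M = "\<lambda>k. generate G (H \<union> lower_central_in A k)"
  note lc = lower_central_in_subgroup[OF A(1)]
  have Ac: "A \<subseteq> carrier G" using A(1) by (rule subgroup.subset)
  have gens: "H \<union> lower_central_in A k \<subseteq> A" for k using H(2) lc by blast
  have sg: "subgroup (?M k) G" for k
    using gens Ac by (intro generate_is_subgroup) blast
  have lc_dec: "lower_central_in A (Suc k) \<subseteq> lower_central_in A k" for k
  proof -
    have "central_series G A (\<lambda>k. lower_central_in A (k - 1))"
      unfolding central_series_def
    proof (intro conjI allI ballI)
      fix k a b assume "a \<in> lower_central_in A (k - 1)" "b \<in> A"
      then show "commutator G a b \<in> lower_central_in A (Suc k - 1)"
        using lc A(1) commutator_in_lower_central_Suc[OF A(1), of a "k - 1" b]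
        by (cases k) (auto simp: commutator_def subgroup.m_closed subgroup.m_inv_closed)
    qed (use lc in auto)
    from lower_central_in_subset_central_series[OF A(1) this, of "Suc k"] show ?thesis by simp
  qed
  have "subnormal G (?M k)" for k
  proof (induction k)
    case 0
    have "?M 0 = A"
      using H(2) A(1) generate_subgroup_incl[of "H \<union> A" A] by (auto intro: generate.incl)
    then show ?case using A(2) by simp
  next
    case (Suc k)
    have sub: "?M (Suc k) \<subseteq> ?M k"
      using lc_dec[of k] by (intro mono_generate) blast
    have "conj_invariant G (?M (Suc k)) (H \<union> lower_central_in A k)"
    proof (rule conj_invariant_generate)
      fix y g assume y: "y \<in> H \<union> lower_central_in A (Suc k)" and g: "g \<in> H \<union> lower_central_in A k"
      have yA: "y \<in> A" and gA: "g \<in> A" using y g gens by blast+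
      consider "y \<in> H" "g \<in> H" | "y \<in> lower_central_in A (Suc k)" | "g \<in> lower_central_in A k"
        using y g by blast
      then show "conjugate G y g \<in> ?M (Suc k)"
      proof cases
        case 1
        then show ?thesis
          using conj_invariantD[OF conj_invariant_subgroup_self[OF H(1)]] by (blast intro: generate.incl)
      next
        case 2
        then show ?thesis
          using conj_invariantD[OF conj_invariant_lower_central[OF A(1) Ac
                conj_invariant_subgroup_self[OF A(1)]]] gA
          by (blast intro: generate.incl)
      next
        case 3
        have carr: "y \<in> carrier G" "g \<in> carrier G" using yA gA Ac by blast+
        have "commutator G g y \<in> lower_central_in A (Suc k)"
          by (rule commutator_in_lower_central_Suc[OF A(1) 3 yA])
        then have "inv (commutator G g y) \<in> lower_central_in A (Suc k)"
          using lc[of "Suc k"] by (intro subgroup.m_inv_closed) (simp_all del: lower_central.simps)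
        moreover have "commutator G y g = inv (commutator G g y)"
          using carr by (simp add: commutator_def word_simps)
        ultimately have "commutator G y g \<in> lower_central_in A (Suc k)" by (simp only:)
        then have "y \<otimes> commutator G y g \<in> ?M (Suc k)"
          by (intro generate.eng generate.incl[OF y] generate.incl[OF UnI2])
        then show ?thesis
          using carr by (simp only: conjugate_eq_mult_commutator)
      qed
    next
      show "H \<union> lower_central_in A (Suc k) \<subseteq> carrier G" "H \<union> lower_central_in A k \<subseteq> carrier G"
        using gens Ac by (meson subset_trans)+
    qed
    then have "conj_invariant G (?M (Suc k)) (?M k)"
    proof (rule conj_invariant_generate_right[rotated 3])
      show "?M (Suc k) \<subseteq> carrier G" by (rule subgroup.subset[OF sg])
      show "H \<union> lower_central_in A k \<subseteq> carrier G" using gens Ac by (meson subset_trans)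
      show "inv g \<in> H \<union> lower_central_in A k" if "g \<in> H \<union> lower_central_in A k" for g
        using that H(1) lc[of k] by (auto intro: subgroup.m_inv_closed)
    qed
    then have "?M (Suc k) \<lhd> G\<lparr>carrier := ?M k\<rparr>"
      using sg sub by (intro normal_in_subgroup)
    then show ?case using Suc by (rule subnormal.step[rotated])
  qed
  moreover obtain c where "lower_central_in A c = {\<one>}"
    using nil by (auto simp: nilpotent_def)
  moreover have "generate G (H \<union> {\<one>}) = H"
    using H(1) generate_subgroup_incl[of "H \<union> {\<one>}" H] subgroup.one_closed
    by (auto intro: generate.incl)
  ultimately show ?thesis by metis
qed

end

section \<open>Fitting's theorem\<close>

context group
begin

text \<open>
  Let \<open>F\<close> be the group generated by \<open>U\<close> and \<open>V\<close>. An element of \<open>\<gamma>\<^sub>i(U) \<inter> \<gamma>\<^sub>j(V)\<close>, where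
  \<open>\<gamma>\<^sub>0\<close> stands for \<open>F\<close>, moves up in \<open>i\<close> on taking a commutator with an element of \<open>U\<close> and in \<open>j\<close>
  with one of \<open>V\<close>, and the other index is kept because \<open>U\<close> and \<open>V\<close> are normal in \<open>F\<close>. The subgroups
  generated by these intersections with \<open>i + j = m\<close> thus form a central series of \<open>F\<close>. If \<open>c\<close> and \<open>d\<close>
  are the classes of \<open>U\<close> and \<open>V\<close>, it is trivial at \<open>m = c + d + 1\<close>, where \<open>i > c\<close> or \<open>j > d\<close>.
\<close>

theorem nilpotent_generate_Un:
  assumes U: "subgroup U G" "nilpotent (G\<lparr>carrier := U\<rparr>)" "conj_invariant G U V"
    and V: "subgroup V G" "nilpotent (G\<lparr>carrier := V\<rparr>)" "conj_invariant G V U"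
  shows "nilpotent (G\<lparr>carrier := generate G (U \<union> V)\<rparr>)"
proof -
  define F where "F = generate G (U \<union> V)"
  have UVc: "U \<union> V \<subseteq> carrier G" using U V subgroup.subset by blast
  have UVF: "U \<union> V \<subseteq> F" by (auto simp: F_def intro: generate.incl)
  have F: "subgroup F G" unfolding F_def using UVc by (rule generate_is_subgroup)
  have Fc: "F \<subseteq> carrier G" using F by (rule subgroup.subset)
  have invariant: "conj_invariant G N F"
    if "subgroup N G" "conj_invariant G N (U \<union> V)" for N
    unfolding F_def
  proof (rule conj_invariant_generate_right[OF _ UVc _ that(2)])
    show "N \<subseteq> carrier G" using that(1) by (rule subgroup.subset)
    show "inv g \<in> U \<union> V" if "g \<in> U \<union> V" for g
      using that U V by (auto intro: subgroup.m_inv_closed)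
  qed
  have "conj_invariant G U (U \<union> V)" "conj_invariant G V (U \<union> V)"
    using U V conj_invariant_subgroup_self by (simp_all add: conj_invariant_def ball_Un)
  then have UF: "conj_invariant G U F" and VF: "conj_invariant G V F"
    using U(1) V(1) by (simp_all add: invariant)
  \<comment> \<open>the shift by one makes \<open>\<gamma> A (Suc k)\<close> the usual \<open>\<gamma>\<^sub>k\<^sub>+\<^sub>1(A)\<close> and lets \<open>F\<close> be the term below index 1\<close>
  define \<gamma> where "\<gamma> A i = (case i of 0 \<Rightarrow> F | Suc k \<Rightarrow> lower_central_in A k)" for A and i :: nat
  have sub: "subgroup (\<gamma> A i) G" if "subgroup A G" for A i
    using that F lower_central_in_subgroup by (auto simp: \<gamma>_def split: nat.split)
  have inv: "conj_invariant G (\<gamma> A i) F" if "subgroup A G" "conj_invariant G A F" for A i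
    using that Fc conj_invariant_lower_central conj_invariant_subgroup_self[OF F]
    by (auto simp: \<gamma>_def split: nat.split)
  have down: "commutator G a b \<in> \<gamma> A (Suc i)"
    if A: "subgroup A G" "A \<subseteq> F" "conj_invariant G A F" and ab: "a \<in> \<gamma> A i" "b \<in> A" for A a b i
  proof (cases i)
    case 0
    have carr: "a \<in> carrier G" "b \<in> carrier G" using 0 ab A Fc by (auto simp: \<gamma>_def)
    have "conjugate G (inv b) a \<otimes> b \<in> A"
      using A ab 0 by (auto simp: \<gamma>_def conj_invariant_def intro!: subgroup.m_closed subgroup.m_inv_closed)
    then show ?thesis
      using carr 0 by (simp add: commutator_eq_conjugate_mult \<gamma>_def)
  next
    case (Suc k)
    then show ?thesis
      using commutator_in_lower_central_Suc[OF A(1)] ab by (simp add: \<gamma>_def del: lower_central.simps)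
  qed
  have stay: "commutator G a b \<in> \<gamma> A i"
    if A: "subgroup A G" "conj_invariant G A F" and ab: "a \<in> \<gamma> A i" "b \<in> F" for A a b i
  proof -
    have "inv a \<otimes> conjugate G a b \<in> \<gamma> A i"
      using conj_invariantD[OF inv[OF A] ab(2,1)] ab(1) sub[OF A(1)]
      by (blast intro: subgroup.m_closed subgroup.m_inv_closed)
    then show ?thesis
      using ab Fc subgroup.subset[OF sub[OF A(1)]] by (auto simp: commutator_eq_inv_mult_conjugate subset_eq)
  qed
  define W where "W m = (\<Union>i\<le>m. \<gamma> U i \<inter> \<gamma> V (m - i))" for m
  define L where "L m = generate G (W m)" for m
  have Wc: "W m \<subseteq> carrier G" for m
    using subgroup.subset[OF sub[OF U(1)]] by (auto simp: W_def)
  have L_sub: "subgroup (L m) G" for m unfolding L_def by (rule generate_is_subgroup[OF Wc])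
  have L_inv: "conj_invariant G (L m) F" for m
    unfolding L_def
  proof (rule conj_invariant_generate[OF Wc Fc])
    fix y g assume y: "y \<in> W m" and g: "g \<in> F"
    then obtain i where i: "i \<le> m" "y \<in> \<gamma> U i \<inter> \<gamma> V (m - i)" by (auto simp: W_def)
    have "conjugate G y g \<in> \<gamma> U i \<inter> \<gamma> V (m - i)"
      using conj_invariantD[OF conj_invariant_Int[OF inv[OF U(1) UF] inv[OF V(1) VF]] g i(2)] .
    then show "conjugate G y g \<in> generate G (W m)"
      using i(1) by (auto simp: W_def intro: generate.incl)
  qed
  have comm: "commutator G a b \<in> L (Suc m)" if a: "a \<in> L m" and b: "b \<in> F" for a b m
  proof (rule commutator_generate_in[OF L_sub Wc UVc])
    have "L m \<subseteq> F"
      unfolding L_def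
    proof (rule generate_subgroup_incl[OF _ F])
      have "\<gamma> U i \<subseteq> F" for i
        using lower_central_in_subgroup[OF U(1)] UVF by (auto simp: \<gamma>_def split: nat.splits)
      then show "W m \<subseteq> F" by (auto simp: W_def)
    qed
    then show "conj_invariant G (L (Suc m)) (generate G (W m))"
      using conj_invariant_mono[OF L_inv] by (simp add: L_def)
    show "conj_invariant G (L (Suc m)) (generate G (U \<union> V))"
      using L_inv by (simp add: F_def)
    show "a \<in> generate G (W m)" using a by (simp add: L_def)
    show "b \<in> generate G (U \<union> V)" using b by (simp add: F_def)
    fix x y assume x: "x \<in> W m" and y: "y \<in> U \<union> V"
    obtain i where i: "i \<le> m" "x \<in> \<gamma> U i" "x \<in> \<gamma> V (m - i)" using x by (auto simp: W_def)
    have yF: "y \<in> F" using y UVF by blast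
    from y show "commutator G x y \<in> L (Suc m)"
    proof
      assume "y \<in> U"
      then have "commutator G x y \<in> \<gamma> U (Suc i) \<inter> \<gamma> V (Suc m - Suc i)"
        using down[OF U(1) _ UF i(2)] stay[OF V(1) VF i(3) yF] UVF by simp
      moreover have "Suc i \<le> Suc m" using i(1) by simp
      ultimately show ?thesis unfolding L_def W_def by (blast intro: generate.incl)
    next
      assume "y \<in> V"
      then have "commutator G x y \<in> \<gamma> U i \<inter> \<gamma> V (Suc m - i)"
        using down[OF V(1) _ VF i(3)] stay[OF U(1) UF i(2) yF] UVF i(1) by (simp add: Suc_diff_le)
      moreover have "i \<le> Suc m" using i(1) by simp
      ultimately show ?thesis unfolding L_def W_def by (blast intro: generate.incl)
    qed
  qed
  obtain c d where c: "lower_central_in U c = {\<one>}" and d: "lower_central_in V d = {\<one>}"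
    using U(2) V(2) by (auto simp: nilpotent_def)
  have "W (Suc (c + d)) \<subseteq> {\<one>}"
  proof
    fix x assume "x \<in> W (Suc (c + d))"
    then obtain i where i: "i \<le> Suc (c + d)" "x \<in> \<gamma> U i" "x \<in> \<gamma> V (Suc (c + d) - i)"
      by (auto simp: W_def)
    show "x \<in> {\<one>}"
    proof (cases "c < i")
      case True
      then have "\<gamma> U i = {\<one>}"
        using lower_central_in_trivial_mono[OF U(1) c] by (auto simp: \<gamma>_def split: nat.split)
      then show ?thesis using i by simp
    next
      case False
      then have "Suc (c + d) - i > d" by simp
      then have "\<gamma> V (Suc (c + d) - i) = {\<one>}"
        using lower_central_in_trivial_mono[OF V(1) d] by (auto simp: \<gamma>_def split: nat.split)
      then show ?thesis using i by simp
    qed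
  qed
  then have "L (Suc (c + d)) = {\<one>}"
    unfolding L_def using generate_subgroup_incl[OF _ triv_subgroup] generate.one by blast
  moreover have "central_series G F L"
    unfolding central_series_def
  proof (intro conjI allI ballI L_sub comm)
    show "F \<subseteq> L 0" by (auto simp: L_def W_def \<gamma>_def intro: generate.incl)
  qed
  ultimately show ?thesis
    using nilpotent_iff_central_series[OF F] by (auto simp: F_def)
qed

section \<open>Locally nilpotent normal subgroups\<close>

lemma locally_nilpotent_iff:
  assumes H: "subgroup H G"
  shows "locally_nilpotent (G\<lparr>carrier := H\<rparr>) \<longleftrightarrow>
    (\<forall>S. finite S \<and> S \<subseteq> H \<longrightarrow> nilpotent (G\<lparr>carrier := generate G S\<rparr>))"
proof -
  have "subgroup_generated (G\<lparr>carrier := H\<rparr>) S = G\<lparr>carrier := generate G S\<rparr>" if "S \<subseteq> H" for S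
    using that generate_consistent[OF that H] by (simp add: subgroup_generated_def Int_absorb1)
  then show ?thesis by (auto simp: locally_nilpotent_def)
qed

lemma nilpotent_imp_locally_nilpotent:
  assumes H: "subgroup H G" and "nilpotent (G\<lparr>carrier := H\<rparr>)"
  shows "locally_nilpotent (G\<lparr>carrier := H\<rparr>)"
  unfolding locally_nilpotent_iff[OF H]
proof (intro allI impI)
  fix S assume S: "finite S \<and> S \<subseteq> H"
  then have "subgroup (generate G S) G"
    using subgroup.subset[OF H] by (intro generate_is_subgroup) blast
  then show "nilpotent (G\<lparr>carrier := generate G S\<rparr>)"
    using nilpotent_subgroup[OF H _ generate_subgroup_incl[OF _ H] assms(2)] S by blast
qed

text \<open>
  The iterated commutators \<open>[d, s\<^sub>1, \<dots>, s\<^sub>m]\<close> with \<open>d\<close> in \<open>C\<close> and all \<open>s\<^sub>i\<close> in \<open>S\<close> lie in the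
  \<open>m\<close>-th term of the lower central series of the group generated by \<open>S \<union> C\<close>, so those with \<open>m\<close> up to
  the nilpotency class already give a closed set. This replaces the fact that subgroups of finitely
  generated nilpotent groups are finitely generated. The minimality of \<open>D\<close> serves to place \<open>D\<close> inside
  the subgroups under consideration.
\<close>

lemma finite_commutator_closed_set:
  assumes S: "finite S" "S \<subseteq> carrier G" and C: "finite C" "C \<subseteq> carrier G"
    and nil: "nilpotent (G\<lparr>carrier := generate G (S \<union> C)\<rparr>)"
  obtains D where "finite D" "C \<subseteq> D"
    and "\<forall>d\<in>D. \<forall>s\<in>S. commutator G d s \<in> D"
    and "\<forall>M. C \<subseteq> M \<and> (\<forall>a\<in>M. \<forall>s\<in>S. commutator G a s \<in> M) \<longrightarrow> D \<subseteq> M"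
proof -
  define E where "E = rec_nat C (\<lambda>_ E. (\<lambda>(d, s). commutator G d s) ` (E \<times> S))"
  have E_simps: "E 0 = C" "E (Suc m) = (\<lambda>(d, s). commutator G d s) ` (E m \<times> S)" for m
    by (simp_all add: E_def)
  define A where "A = generate G (S \<union> C)"
  have A: "subgroup A G" unfolding A_def using S C by (intro generate_is_subgroup) blast
  have E_lc: "E m \<subseteq> lower_central_in A m" for m
  proof (induction m)
    case 0
    then show ?case by (auto simp: E_simps A_def intro: generate.incl)
  next
    case (Suc m)
    have "commutator G d s \<in> lower_central_in A (Suc m)" if "d \<in> E m" "s \<in> S" for d s
      using Suc that by (intro commutator_in_lower_central_Suc[OF A]) (auto simp: A_def intro: generate.incl)
    then show ?case by (auto simp: E_simps simp del: lower_central.simps)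
  qed
  obtain c where c: "lower_central_in A c = {\<one>}"
    using nil by (auto simp: nilpotent_def A_def)
  have "finite (E m)" for m
    by (induction m) (simp_all add: E_simps C S)
  show thesis
  proof (rule that[of "\<Union>m\<le>c. E m"])
    show "finite (\<Union>m\<le>c. E m)" using \<open>\<And>m. finite (E m)\<close> by simp
    show "C \<subseteq> (\<Union>m\<le>c. E m)" using E_simps(1) by blast
    show "\<forall>d\<in>(\<Union>m\<le>c. E m). \<forall>s\<in>S. commutator G d s \<in> (\<Union>m\<le>c. E m)"
    proof (intro ballI)
      fix d s assume d: "d \<in> (\<Union>m\<le>c. E m)" and s: "s \<in> S"
      obtain m where m: "m \<le> c" "d \<in> E m" using d by blast
      show "commutator G d s \<in> (\<Union>m\<le>c. E m)"
      proof (cases "m = c")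
        \<comment> \<open>the last level consists of the identity at most, and \<open>[1, s] = 1\<close>\<close>
        case True
        then have "d = \<one>" using m E_lc[of c] c by auto
        then have "commutator G d s = d" using s S by auto
        then show ?thesis using d by simp
      next
        case False
        then have "Suc m \<le> c" "commutator G d s \<in> E (Suc m)" using m s by (auto simp: E_simps)
        then show ?thesis by blast
      qed
    qed
    show "\<forall>M. C \<subseteq> M \<and> (\<forall>a\<in>M. \<forall>s\<in>S. commutator G a s \<in> M) \<longrightarrow> (\<Union>m\<le>c. E m) \<subseteq> M"
    proof (intro allI impI)
      fix M assume M: "C \<subseteq> M \<and> (\<forall>a\<in>M. \<forall>s\<in>S. commutator G a s \<in> M)"
      have "E m \<subseteq> M" for m by (induction m) (use M in \<open>auto simp: E_simps\<close>)
      then show "(\<Union>m\<le>c. E m) \<subseteq> M" by blast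
    qed
  qed
qed

text \<open>
  The group constructed here is the normal closure of \<open>T\<close> in the group generated by \<open>S \<union> T\<close>. That it is
  finitely generated, and therefore nilpotent by the local nilpotency of \<open>K\<close>, is a consequence of the
  local nilpotency of \<open>H\<close>.
\<close>

lemma finitely_generated_nilpotent_cover:
  assumes H: "H \<lhd> G" "locally_nilpotent (G\<lparr>carrier := H\<rparr>)"
    and K: "K \<lhd> G" "locally_nilpotent (G\<lparr>carrier := K\<rparr>)"
    and S: "finite S" "S \<subseteq> H" "\<And>s. s \<in> S \<Longrightarrow> inv s \<in> S"
    and T: "finite T" "T \<subseteq> K" "\<And>t. t \<in> T \<Longrightarrow> inv t \<in> T"
  obtains U where "subgroup U G" "nilpotent (G\<lparr>carrier := U\<rparr>)" "T \<subseteq> U"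
    "U \<subseteq> generate G (S \<union> T)" "conj_invariant G U (generate G (S \<union> T))"
proof -
  have Hs: "subgroup H G" "conj_invariant G H (carrier G)"
    and Ks: "subgroup K G" "conj_invariant G K (carrier G)"
    using H(1) K(1) by (simp_all add: normal_iff_conj_invariant)
  have Hc: "H \<subseteq> carrier G" and Kc: "K \<subseteq> carrier G" using Hs Ks subgroup.subset by auto
  have Sc: "S \<subseteq> carrier G" and Tc: "T \<subseteq> carrier G" using S T Hc Kc by auto
  have commH: "commutator G a s \<in> H" if "a \<in> carrier G" "s \<in> H" for a s
    using that Hs Hc commutator_eq_conjugate_mult[of a s]
    by (auto simp: conj_invariant_def subgroup.m_closed subgroup.m_inv_closed)
  have commK: "commutator G a s \<in> K" if "a \<in> K" "s \<in> carrier G" for a s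
    using that Ks Kc commutator_eq_inv_mult_conjugate[of a s]
    by (auto simp: conj_invariant_def subgroup.m_closed subgroup.m_inv_closed)
  define F where "F = generate G (S \<union> T)"
  have STF: "S \<subseteq> F" "T \<subseteq> F" by (auto simp: F_def intro: generate.incl)
  have F: "subgroup F G" unfolding F_def using Sc Tc by (intro generate_is_subgroup) blast
  have Fc: "F \<subseteq> carrier G" using F by (rule subgroup.subset)
  have commF: "commutator G a s \<in> F" if "a \<in> F" "s \<in> F" for a s
    using that F by (simp add: commutator_def subgroup.m_closed subgroup.m_inv_closed)
  define C where "C = (\<lambda>(t, s). commutator G t s) ` (T \<times> S)"
  have "commutator G t s \<in> H \<inter> K \<inter> F" if "t \<in> T" "s \<in> S" for t s
    using commH[of t s] commK[of t s] commF[of t s] that S(2) T(2) Sc Tc STF by blast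
  then have C: "finite C" "C \<subseteq> H \<inter> K \<inter> F"
    using S(1) T(1) by (auto simp: C_def)
  have "S \<union> C \<subseteq> H" "finite (S \<union> C)" using S C by auto
  then have nil: "nilpotent (G\<lparr>carrier := generate G (S \<union> C)\<rparr>)"
    using H(2) unfolding locally_nilpotent_iff[OF Hs(1)] by blast
  have Cc: "C \<subseteq> carrier G" using C(2) Hc by blast
  obtain D where D: "finite D" "C \<subseteq> D"
    and D_comm: "\<forall>d\<in>D. \<forall>s\<in>S. commutator G d s \<in> D"
    and D_min: "\<forall>M. C \<subseteq> M \<and> (\<forall>a\<in>M. \<forall>s\<in>S. commutator G a s \<in> M) \<longrightarrow> D \<subseteq> M"
    by (rule finite_commutator_closed_set[OF S(1) Sc C(1) Cc nil])
  have "\<forall>a\<in>K \<inter> F. \<forall>s\<in>S. commutator G a s \<in> K \<inter> F"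
    using commK commF Sc STF(1) by blast
  then have DKF: "D \<subseteq> K \<inter> F"
    using D_min[THEN spec, of "K \<inter> F"] C(2) by simp
  define U where "U = generate G (T \<union> D)"
  have gens: "T \<union> D \<subseteq> K \<inter> F" using T DKF STF by auto
  then have gc: "T \<union> D \<subseteq> carrier G" using Fc by blast
  have U: "subgroup U G" unfolding U_def by (rule generate_is_subgroup[OF gc])
  have "nilpotent (G\<lparr>carrier := U\<rparr>)"
    using K(2) T D gens by (simp add: locally_nilpotent_iff[OF Ks(1)] U_def)
  moreover have "T \<subseteq> U" by (auto simp: U_def intro: generate.incl)
  moreover have "U \<subseteq> F"
    unfolding U_def using gens F by (intro generate_subgroup_incl) auto
  moreover have "conj_invariant G U F"
    unfolding F_def
  proof (rule conj_invariant_generate_right)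
    show "U \<subseteq> carrier G" using U by (rule subgroup.subset)
    show "S \<union> T \<subseteq> carrier G" using Sc Tc by blast
    show "inv g \<in> S \<union> T" if "g \<in> S \<union> T" for g using that S T by blast
    have "conj_invariant G U S"
      unfolding U_def
    proof (rule conj_invariant_generate[OF gc Sc])
      fix y g assume y: "y \<in> T \<union> D" and g: "g \<in> S"
      have "commutator G y g \<in> D"
        using y g D(2) D_comm by (auto simp: C_def)
      then have "y \<otimes> commutator G y g \<in> generate G (T \<union> D)"
        using y by (blast intro: generate.intros)
      then show "conjugate G y g \<in> generate G (T \<union> D)"
        using conjugate_eq_mult_commutator[of y g] y g gc Sc by (simp add: subset_eq)
    qed
    moreover have "conj_invariant G U T"
      using conj_invariant_mono[OF conj_invariant_subgroup_self[OF U] \<open>T \<subseteq> U\<close>] .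
    ultimately show "conj_invariant G U (S \<union> T)" by (auto simp: conj_invariant_def)
  qed
  ultimately show thesis using U by (intro that) (simp_all add: F_def)
qed

text \<open>
  Finitely many elements of \<open>HK\<close> involve only finitely many factors from \<open>H\<close> and \<open>K\<close>; both families
  are covered by nilpotent subgroups that are normal in the group they generate.
\<close>

lemma locally_nilpotent_set_mult:
  assumes H: "H \<lhd> G" "locally_nilpotent (G\<lparr>carrier := H\<rparr>)"
    and K: "K \<lhd> G" "locally_nilpotent (G\<lparr>carrier := K\<rparr>)"
  shows "locally_nilpotent (G\<lparr>carrier := H <#> K\<rparr>)"
proof -
  have HK: "subgroup (H <#> K) G"
    using normal_subgroup_set_mult_closed[OF H(1) K(1)] by (rule normal_imp_subgroup)
  have Hs: "subgroup H G" and Ks: "subgroup K G" using H K normal_imp_subgroup by auto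
  have "nilpotent (G\<lparr>carrier := generate G R\<rparr>)" if R: "finite R" "R \<subseteq> H <#> K" for R
  proof -
    have "\<forall>r\<in>R. \<exists>h k. h \<in> H \<and> k \<in> K \<and> r = h \<otimes> k"
      using R(2) by (auto simp: set_mult_def)
    then obtain h k where hk: "\<And>r. r \<in> R \<Longrightarrow> h r \<in> H \<and> k r \<in> K \<and> r = h r \<otimes> k r"
      by metis
    define S where "S = h ` R \<union> (\<lambda>r. inv (h r)) ` R"
    define T where "T = k ` R \<union> (\<lambda>r. inv (k r)) ` R"
    have S: "finite S" "S \<subseteq> H" "\<And>s. s \<in> S \<Longrightarrow> inv s \<in> S"
      using R(1) hk subgroup.m_inv_closed[OF Hs] subgroup.mem_carrier[OF Hs] by (auto simp: S_def)
    have T: "finite T" "T \<subseteq> K" "\<And>s. s \<in> T \<Longrightarrow> inv s \<in> T"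
      using R(1) hk subgroup.m_inv_closed[OF Ks] subgroup.mem_carrier[OF Ks] by (auto simp: T_def)
    obtain U where U: "subgroup U G" "nilpotent (G\<lparr>carrier := U\<rparr>)" "T \<subseteq> U"
      "U \<subseteq> generate G (S \<union> T)" "conj_invariant G U (generate G (S \<union> T))"
      using finitely_generated_nilpotent_cover[OF H K S T] by blast
    obtain V where V: "subgroup V G" "nilpotent (G\<lparr>carrier := V\<rparr>)" "S \<subseteq> V"
      "V \<subseteq> generate G (S \<union> T)" "conj_invariant G V (generate G (S \<union> T))"
      using finitely_generated_nilpotent_cover[OF K H T S] by (metis Un_commute)
    have nil: "nilpotent (G\<lparr>carrier := generate G (U \<union> V)\<rparr>)"
      using nilpotent_generate_Un[OF U(1,2) conj_invariant_mono[OF U(5) V(4)]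
          V(1,2) conj_invariant_mono[OF V(5) U(4)]] .
    have UV: "subgroup (generate G (U \<union> V)) G"
      using subgroup.subset[OF U(1)] subgroup.subset[OF V(1)] by (intro generate_is_subgroup) blast
    have Rc: "R \<subseteq> carrier G" using R(2) subgroup.subset[OF HK] by blast
    have "r \<in> generate G (U \<union> V)" if r: "r \<in> R" for r
    proof -
      have "h r \<in> U \<union> V" "k r \<in> U \<union> V" using r U(3) V(3) by (auto simp: S_def T_def)
      then have "h r \<otimes> k r \<in> generate G (U \<union> V)" by (blast intro: generate.intros)
      then show ?thesis using hk[OF r] by simp
    qed
    then have "generate G R \<subseteq> generate G (U \<union> V)"
      using UV by (intro generate_subgroup_incl) blast
    then show ?thesis
      using nilpotent_subgroup[OF UV generate_is_subgroup[OF Rc] _ nil] by blast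
  qed
  then show ?thesis by (simp add: locally_nilpotent_iff[OF HK])
qed

text \<open>
  The union \<open>R\<close> of all locally nilpotent normal subgroups is directed, because the product of two of
  them is again one. Being a subgroup and being locally nilpotent only involve finitely many elements
  at a time, so \<open>R\<close> inherits them and is the greatest such subgroup.
\<close>

theorem subset_hirsch_plotkin_radical:
  assumes "N \<lhd> G" "locally_nilpotent (G\<lparr>carrier := N\<rparr>)"
  shows "N \<subseteq> hirsch_plotkin_radical G"
proof -
  define P where "P H \<longleftrightarrow> H \<lhd> G \<and> locally_nilpotent (G\<lparr>carrier := H\<rparr>)" for H
  define R where "R = \<Union>{H. P H}"
  have PD: "subgroup H G" "conj_invariant G H (carrier G)" if "P H" for H
    using that by (simp_all add: P_def normal_iff_conj_invariant)
  have join: "\<exists>M. P M \<and> H \<subseteq> M \<and> K \<subseteq> M \<and> (\<forall>h\<in>H. \<forall>k\<in>K. h \<otimes> k \<in> M)" if P: "P H" "P K" for H K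
  proof (intro exI conjI)
    show "P (H <#> K)"
      using P locally_nilpotent_set_mult normal_subgroup_set_mult_closed by (simp add: P_def)
    show prod: "\<forall>h\<in>H. \<forall>k\<in>K. h \<otimes> k \<in> H <#> K" by (auto simp: set_mult_def)
    have ones: "\<one> \<in> H" "\<one> \<in> K" using P[THEN PD(1)] by (simp_all add: subgroup.one_closed)
    have "h \<in> H <#> K" if "h \<in> H" for h
      using prod[rule_format, OF that ones(2)] subgroup.mem_carrier[OF PD(1)[OF P(1)] that] by simp
    then show "H \<subseteq> H <#> K" by blast
    have "k \<in> H <#> K" if "k \<in> K" for k
      using prod[rule_format, OF ones(1) that] subgroup.mem_carrier[OF PD(1)[OF P(2)] that] by simp
    then show "K \<subseteq> H <#> K" by blast
  qed
  have P_N: "P N" using assms by (simp add: P_def)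
  have R: "subgroup R G"
  proof (rule subgroupI)
    show "R \<subseteq> carrier G" using PD(1) subgroup.subset by (auto simp: R_def)
    show "R \<noteq> {}" using P_N subgroup.one_closed[OF PD(1)[OF P_N]] by (auto simp: R_def)
    show "inv a \<in> R" if a: "a \<in> R" for a
    proof -
      obtain H where "P H" "a \<in> H" using a by (auto simp: R_def)
      moreover from this have "inv a \<in> H" by (intro subgroup.m_inv_closed PD(1))
      ultimately show ?thesis by (auto simp: R_def)
    qed
    show "a \<otimes> b \<in> R" if ab: "a \<in> R" "b \<in> R" for a b
    proof -
      obtain H K where "P H" "a \<in> H" "P K" "b \<in> K" using ab by (auto simp: R_def)
      then show ?thesis using join[of H K] by (auto simp: R_def)
    qed
  qed
  have "conj_invariant G R (carrier G)"
    using PD(2) by (fastforce simp: R_def conj_invariant_def)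
  with R have normal: "R \<lhd> G" by (simp add: normal_iff_conj_invariant)
  have single: "\<exists>H. P H \<and> S \<subseteq> H" if "finite S" "S \<subseteq> R" for S
    using that
  proof (induction S)
    case empty
    then show ?case using P_N by blast
  next
    case (insert a S)
    then obtain H K where "P H" "S \<subseteq> H" "P K" "a \<in> K" unfolding R_def by blast
    then show ?case using join[of H K] by blast
  qed
  have "locally_nilpotent (G\<lparr>carrier := R\<rparr>)"
    unfolding locally_nilpotent_iff[OF R]
  proof (intro allI impI)
    fix S assume "finite S \<and> S \<subseteq> R"
    moreover from this obtain H where "P H" "S \<subseteq> H" using single by blast
    ultimately show "nilpotent (G\<lparr>carrier := generate G S\<rparr>)"
      using locally_nilpotent_iff[OF PD(1)] by (auto simp: P_def)
  qed
  with normal have "P R" by (simp add: P_def)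
  moreover have "H \<le> R" if "P H" for H using that by (auto simp: R_def)
  ultimately have "Greatest P = R" by (rule Greatest_equality)
  moreover have "hirsch_plotkin_radical G = Greatest P"
    by (simp add: hirsch_plotkin_radical_def P_def[abs_def])
  ultimately show ?thesis using P_N by (auto simp: R_def)
qed

end

section \<open>Left 3-Engel elements\<close>

context group
begin

lemma normal_closure_eq_generate:
  assumes z: "z \<in> carrier G"
  shows "normal_closure G z = generate G {conjugate G z g | g. g \<in> carrier G}" (is "_ = ?N")
proof
  have C: "{conjugate G z g | g. g \<in> carrier G} \<subseteq> carrier G" using z by auto
  have "conj_invariant G ?N (carrier G)"
  proof (rule conj_invariant_generate[OF C order_refl])
    fix y g assume "y \<in> {conjugate G z g | g. g \<in> carrier G}" "g \<in> carrier G"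
    then show "conjugate G y g \<in> ?N"
      using z by (auto simp: conjugate_conjugate intro!: generate.incl)
  qed
  then have "?N \<lhd> G"
    using generate_is_subgroup[OF C] by (simp add: normal_iff_conj_invariant)
  moreover have "conjugate G z \<one> \<in> ?N" by (blast intro: generate.incl one_closed)
  then have "z \<in> ?N" using z by simp
  ultimately show "normal_closure G z \<subseteq> ?N" by (auto simp: normal_closure_def)
  have "?N \<subseteq> M" if M: "M \<lhd> G" "z \<in> M" for M
    using M by (intro generate_subgroup_incl) (auto simp: normal_iff_conj_invariant conj_invariant_def)
  then show "?N \<subseteq> normal_closure G z" by (auto simp: normal_closure_def)
qed

lemma normal_closure_normal:
  assumes "z \<in> carrier G"
  shows "normal_closure G z \<lhd> G"
proof -
  have "carrier G \<in> {N. N \<lhd> G \<and> z \<in> N}" using assms normal_self by simp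
  then have "subgroup (normal_closure G z) G"
    unfolding normal_closure_def by (intro subgroups_Inter) (auto simp: normal_imp_subgroup)
  moreover have "conj_invariant G (normal_closure G z) (carrier G)"
    by (auto simp: normal_closure_def normal_iff_conj_invariant conj_invariant_def)
  ultimately show ?thesis by (simp add: normal_iff_conj_invariant)
qed

lemma mem_normal_closure: "z \<in> normal_closure G z"
  by (simp add: normal_closure_def)

lemma normal_closure_one: "normal_closure G \<one> = {\<one>}"
proof -
  have "normal_closure G \<one> \<subseteq> {\<one>}" using one_is_normal by (auto simp: normal_closure_def)
  then show ?thesis using mem_normal_closure by blast
qed

lemma commutator_eq_one_iff:
  assumes "a \<in> carrier G" "b \<in> carrier G"
  shows "commutator G a b = \<one> \<longleftrightarrow> a \<otimes> b = b \<otimes> a"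
proof -
  have "commutator G a b = inv (b \<otimes> a) \<otimes> (a \<otimes> b)"
    using assms by (simp add: commutator_def word_simps)
  then show ?thesis
    using assms by (metis inv_equality inv_inv l_inv m_closed inv_closed)
qed

text \<open>
  If \<open>a\<close> commutes with \<open>c = [a, b]\<close>, then \<open>(a\<^sup>i)\<^sup>b = (ac)\<^sup>i = a\<^sup>ic\<^sup>i\<close>.
\<close>

lemma commutator_pow_left:
  assumes ab: "a \<in> carrier G" "b \<in> carrier G"
    and comm: "a \<otimes> commutator G a b = commutator G a b \<otimes> a"
  shows "commutator G (a [^] (i::nat)) b = commutator G a b [^] i"
proof -
  let ?c = "commutator G a b"
  have "conjugate G (a [^] i) b = (a \<otimes> ?c) [^] i"
    using ab by (simp add: conjugate_pow conjugate_eq_mult_commutator[of a])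
  also have "\<dots> = a [^] i \<otimes> ?c [^] i"
    using ab comm by (intro pow_mult_distrib) simp_all
  finally show ?thesis
    using ab by (simp add: commutator_eq_inv_mult_conjugate word_simps)
qed

lemma inv_commutator:
  "a \<in> carrier G \<Longrightarrow> b \<in> carrier G \<Longrightarrow> inv (commutator G a b) = commutator G b a"
  by (simp add: commutator_def word_simps)

lemma commutes_inv:
  assumes "a \<in> carrier G" "b \<in> carrier G" "a \<otimes> b = b \<otimes> a"
  shows "a \<otimes> inv b = inv b \<otimes> a"
  using assms by (metis inv_closed inv_solve_left m_assoc m_closed r_inv r_one)

lemma commutes_pow:
  assumes "a \<in> carrier G" "b \<in> carrier G" "a \<otimes> b = b \<otimes> a"
  shows "a \<otimes> b [^] (i::nat) = b [^] i \<otimes> a"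
  using assms by (induction i) (simp_all add: m_assoc[symmetric], metis m_assoc nat_pow_closed)

text \<open>
  Bilinearity of the commutator in a group of class 2: both sides equal \<open>[a, b]\<^sup>i\<^sup>j\<close>.
\<close>

lemma commutator_pow_pow:
  assumes ab: "a \<in> carrier G" "b \<in> carrier G"
    and a_comm: "a \<otimes> commutator G a b = commutator G a b \<otimes> a"
    and b_comm: "b \<otimes> commutator G a b = commutator G a b \<otimes> b"
  shows "commutator G (a [^] (i::nat)) (b [^] (j::nat)) = commutator G (a [^] (i * j)) b"
proof -
  let ?c = "commutator G (a [^] i) b"
  have c: "?c = commutator G a b [^] i" using ab a_comm by (rule commutator_pow_left)
  have "b \<otimes> ?c = ?c \<otimes> b"
    unfolding c using ab b_comm by (intro commutes_pow) simp_all
  then have "b \<otimes> commutator G b (a [^] i) = commutator G b (a [^] i) \<otimes> b"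
    using ab commutes_inv[of b ?c] by (simp add: inv_commutator)
  then have "commutator G (b [^] j) (a [^] i) = commutator G b (a [^] i) [^] j"
    using ab by (intro commutator_pow_left) simp_all
  then have "commutator G (a [^] i) (b [^] j) = inv (commutator G b (a [^] i) [^] j)"
    using ab inv_commutator[of "b [^] j" "a [^] i"] by simp
  also have "\<dots> = inv (commutator G b (a [^] i)) [^] j"
    using ab by (simp add: nat_pow_inv)
  also have "\<dots> = ?c [^] j" using ab by (simp add: inv_commutator)
  also have "\<dots> = commutator G a b [^] (i * j)" using ab c by (simp add: nat_pow_pow)
  also have "\<dots> = commutator G (a [^] (i * j)) b"
    using commutator_pow_left[OF ab a_comm, of "i * j"] by simp
  finally show ?thesis .
qed

text \<open>
  With \<open>y = x\<^sup>g\<close>, the relation \<open>[g, x, x, x] = 1\<close> says that \<open>x\<close> commutes with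
  \<open>[y\<^sup>-\<^sup>1x, x] = [y\<^sup>-\<^sup>1, x]\<^sup>x\<close>, hence with \<open>[y\<^sup>-\<^sup>1, x] = (yx\<^sup>-\<^sup>1y\<^sup>-\<^sup>1)x\<close>, and so with \<open>yx\<^sup>-\<^sup>1y\<^sup>-\<^sup>1\<close>.
  Conjugation by \<open>y\<close> turns this into a relation between \<open>x\<^sup>y\<close> and \<open>x\<close>.
\<close>

lemma left_3_engel_commutes:
  assumes x: "x \<in> left_engel 3 G" and g: "g \<in> carrier G"
  shows "x \<otimes> conjugate G x (conjugate G x g) = conjugate G x (conjugate G x g) \<otimes> x"
proof -
  have xc: "x \<in> carrier G" using x by (simp add: left_engel_def)
  define y where "y = conjugate G x g"
  have yc: "y \<in> carrier G" using xc g by (simp add: y_def)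
  let ?w = "commutator G (inv y) x"
  have "commutator G (commutator G (commutator G g x) x) x = \<one>"
    using x g by (simp add: left_engel_def numeral_3_eq_3)
  moreover have "commutator G g x = inv y \<otimes> x"
    using xc g by (simp add: y_def commutator_eq_conjugate_mult conjugate_inv)
  moreover have "commutator G (inv y \<otimes> x) x = conjugate G ?w x"
    using xc yc by (simp add: commutator_mult_left) (simp add: commutator_def word_simps)
  ultimately have "commutator G (conjugate G ?w x) x = \<one>" by simp
  then have "conjugate G ?w x \<otimes> x = x \<otimes> conjugate G ?w x"
    using xc yc by (simp add: commutator_eq_one_iff)
  \<comment> \<open>undoes the conjugation by \<open>x\<close>, conjugates by \<open>y\<close> and clears the inverses of \<open>x\<close>\<close>
  then have "x \<otimes> inv y \<otimes> x \<otimes> (conjugate G ?w x \<otimes> x) \<otimes> inv x \<otimes> inv x \<otimes> y \<otimes> x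
      = x \<otimes> inv y \<otimes> x \<otimes> (x \<otimes> conjugate G ?w x) \<otimes> inv x \<otimes> inv x \<otimes> y \<otimes> x"
    by simp
  then have "inv y \<otimes> (x \<otimes> (y \<otimes> x)) = x \<otimes> (inv y \<otimes> (x \<otimes> y))"
    using xc yc by (simp add: conjugate_def commutator_def word_simps)
  then have "x \<otimes> conjugate G x y = conjugate G x y \<otimes> x"
    using xc yc by (simp add: conjugate_def word_simps)
  then show ?thesis by (simp add: y_def)
qed

text \<open>
  The first part uses \<open>[x, y] = x\<^sup>-\<^sup>1x\<^sup>y\<close>. For the second, \<open>[x, y] = (y\<^sup>x)\<^sup>-\<^sup>1y\<close>, and conjugating the
  relation between \<open>x\<close> and its conjugate by \<open>x\<^sup>h\<close>, \<open>h = g\<^sup>-\<^sup>1\<close>, by \<open>g\<close> shows that \<open>y\<close> commutes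
  with \<open>y\<^sup>x\<close>.
\<close>

lemma left_3_engel_commutator_commutes:
  assumes x: "x \<in> left_engel 3 G" and g: "g \<in> carrier G"
  defines "y \<equiv> conjugate G x g"
  shows "x \<otimes> commutator G x y = commutator G x y \<otimes> x"
    and "y \<otimes> commutator G x y = commutator G x y \<otimes> y"
proof -
  have xc: "x \<in> carrier G" using x by (simp add: left_engel_def)
  have yc: "y \<in> carrier G" using xc g by (simp add: y_def)
  have "x \<otimes> conjugate G x y = conjugate G x y \<otimes> x"
    unfolding y_def by (rule left_3_engel_commutes[OF x g])
  then have "x \<otimes> (inv x \<otimes> conjugate G x y) = (inv x \<otimes> conjugate G x y) \<otimes> x"
    using xc yc by (simp add: m_assoc mult_inv_cancel) (metis conjugate_closed inv_mult_cancel)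
  then show "x \<otimes> commutator G x y = commutator G x y \<otimes> x"
    using xc yc by (simp add: commutator_eq_inv_mult_conjugate)
  let ?u = "conjugate G x (conjugate G x (inv g))"
  have uc: "?u \<in> carrier G" using xc g by simp
  have "conjugate G (x \<otimes> ?u) g = conjugate G (?u \<otimes> x) g"
    using left_3_engel_commutes[OF x, of "inv g"] g by simp
  moreover have "conjugate G ?u g = conjugate G y x"
    using xc g by (simp add: y_def conjugate_def word_simps)
  ultimately have "y \<otimes> conjugate G y x = conjugate G y x \<otimes> y"
    using xc g uc by (simp add: conjugate_mult y_def)
  then have "y \<otimes> inv (conjugate G y x) = inv (conjugate G y x) \<otimes> y"
    using xc yc by (intro commutes_inv) simp_all
  then have "y \<otimes> (inv (conjugate G y x) \<otimes> y) = (inv (conjugate G y x) \<otimes> y) \<otimes> y"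
    using xc yc by (metis conjugate_closed inv_closed m_assoc)
  then show "y \<otimes> commutator G x y = commutator G x y \<otimes> y"
    using xc yc by (simp add: commutator_eq_conjugate_mult conjugate_inv)
qed

text \<open>
  It suffices to treat two generating conjugates, and after conjugation the first is \<open>x\<^sup>i\<close> itself.
  Then \<open>[x\<^sup>i, y\<^sup>j] = [x\<^sup>i\<^sup>j, y]\<close> for the conjugate \<open>y\<close> of \<open>x\<close> at hand.
\<close>

lemma commutator_normal_closures_of_powers:
  assumes x: "x \<in> left_engel 3 G"
    and a: "a \<in> normal_closure G (x [^] (i::nat))" and b: "b \<in> normal_closure G (x [^] (j::nat))"
  shows "commutator G a b \<in> normal_closure G (x [^] (i * j))"
proof -
  have xc: "x \<in> carrier G" using x by (simp add: left_engel_def)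
  let ?N = "normal_closure G (x [^] (i * j))"
  let ?C = "\<lambda>k::nat. {conjugate G (x [^] k) g | g. g \<in> carrier G}"
  have N: "subgroup ?N G" "conj_invariant G ?N (carrier G)"
    using normal_closure_normal[of "x [^] (i * j)"] xc by (simp_all add: normal_iff_conj_invariant)
  have C: "?C k \<subseteq> carrier G" for k using xc by auto
  have nc: "normal_closure G (x [^] k) = generate G (?C k)" for k
    using xc by (simp add: normal_closure_eq_generate)
  show ?thesis
  proof (rule commutator_generate_in[OF N(1) C C])
    show "conj_invariant G ?N (generate G (?C i))" "conj_invariant G ?N (generate G (?C j))"
      using conj_invariant_mono[OF N(2) generate_incl[OF C]] by auto
    show "a \<in> generate G (?C i)" using a by (simp add: nc)
    show "b \<in> generate G (?C j)" using b by (simp add: nc)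
    fix u v assume "u \<in> ?C i" "v \<in> ?C j"
    then obtain g h where g: "g \<in> carrier G" "u = conjugate G (x [^] i) g"
      and h: "h \<in> carrier G" "v = conjugate G (x [^] j) h" by blast
    define y where "y = conjugate G x (h \<otimes> inv g)"
    have hg: "h \<otimes> inv g \<in> carrier G" using g h by simp
    have yc: "y \<in> carrier G" using xc hg by (simp add: y_def)
    have "commutator G (x [^] i) (y [^] j) = commutator G (x [^] (i * j)) y"
      using left_3_engel_commutator_commutes[OF x hg] xc yc
      by (intro commutator_pow_pow) (simp_all add: y_def)
    also have "\<dots> = inv (x [^] (i * j)) \<otimes> conjugate G (x [^] (i * j)) y"
      using xc yc by (simp add: commutator_eq_inv_mult_conjugate)
    also have "\<dots> \<in> ?N"
      using N yc mem_normal_closure[of "x [^] (i * j)"]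
      by (auto simp: conj_invariant_def subgroup.m_closed subgroup.m_inv_closed)
    finally have "conjugate G (commutator G (x [^] i) (y [^] j)) g \<in> ?N"
      using conj_invariantD[OF N(2) g(1)] by blast
    moreover have "conjugate G (y [^] j) g = v"
      using xc g h by (simp add: y_def conjugate_pow[symmetric] conjugate_conjugate m_assoc)
    ultimately show "commutator G u v \<in> ?N"
      using xc yc g by (simp add: conjugate_commutator)
  qed
qed

lemma central_series_powers_of_left_3_engel:
  assumes x: "x \<in> left_engel 3 G"
  shows "central_series G (normal_closure G (x [^] (p::nat))) (\<lambda>k. normal_closure G (x [^] (p ^ Suc k)))"
  unfolding central_series_def
proof (intro conjI allI ballI)
  have xc: "x \<in> carrier G" using x by (simp add: left_engel_def)
  show "subgroup (normal_closure G (x [^] (p ^ Suc k))) G" for k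
    using xc by (intro normal_imp_subgroup normal_closure_normal nat_pow_closed)
  show "normal_closure G (x [^] p) \<subseteq> normal_closure G (x [^] (p ^ Suc 0))" by simp
  fix k a b
  assume "a \<in> normal_closure G (x [^] (p ^ Suc k))" "b \<in> normal_closure G (x [^] p)"
  then have "commutator G a b \<in> normal_closure G (x [^] (p ^ Suc k * p))"
    by (rule commutator_normal_closures_of_powers[OF x])
  then show "commutator G a b \<in> normal_closure G (x [^] (p ^ Suc (Suc k)))"
    by (simp add: mult.commute mult.left_commute)
qed

end

theorem theorem1p1:
  fixes G :: "('a, 'b) monoid_scheme" and p n :: nat and x :: 'a
  assumes "group G"
    and "Factorial_Ring.prime p"
    and "n > 1"
    and "x \<in> left_engel 3 G"
    and "x [^]\<^bsub>G\<^esub> (p ^ n) = \<one>\<^bsub>G\<^esub>"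
  shows "solvable (G\<lparr>carrier := normal_closure G (x [^]\<^bsub>G\<^esub> p)\<rparr>)
    \<and> derived_length (G\<lparr>carrier := normal_closure G (x [^]\<^bsub>G\<^esub> p)\<rparr>) \<le> n - 1
    \<and> x [^]\<^bsub>G\<^esub> p \<in> baer_radical G
    \<and> x [^]\<^bsub>G\<^esub> p \<in> hirsch_plotkin_radical G"
proof -
  interpret group G by fact
  let ?z = "x [^]\<^bsub>G\<^esub> p"
  let ?A = "normal_closure G ?z" and ?L = "\<lambda>k. normal_closure G (x [^]\<^bsub>G\<^esub> (p ^ Suc k))"
  have z: "?z \<in> carrier G" using assms(4) by (simp add: left_engel_def)
  have A: "?A \<lhd> G" "subgroup ?A G"
    using normal_closure_normal[OF z] normal_imp_subgroup by auto
  have L: "central_series G ?A ?L"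
    using assms(4) by (rule central_series_powers_of_left_3_engel)
  have end_L: "?L (n - 1) = {\<one>\<^bsub>G\<^esub>}"
    using assms(3,5) normal_closure_one by simp
  have nil: "nilpotent (G\<lparr>carrier := ?A\<rparr>)"
    using nilpotent_iff_central_series[OF A(2)] L end_L by blast
  have cyc: "subgroup (generate G {?z}) G" "generate G {?z} \<subseteq> ?A"
    using z generate_is_subgroup generate_subgroup_incl[OF _ A(2)] mem_normal_closure by auto
  have "subnormal G ?A"
    using A(1) by (intro subnormal.step[OF subnormal.whole]) simp
  then have "subnormal G (generate G {?z})"
    using subnormal_of_nilpotent[OF A(2) _ nil cyc] by simp
  then have "?z \<in> baer_radical G"
    unfolding baer_radical_def using z by (blast intro: generate.incl)
  moreover have "?z \<in> hirsch_plotkin_radical G"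
    using subset_hirsch_plotkin_radical[OF A(1) nilpotent_imp_locally_nilpotent[OF A(2) nil]]
      mem_normal_closure by blast
  ultimately show ?thesis
    using derived_length_le_of_central_series[OF A(2) L end_L] by simp
qed

end
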